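(* Let $f(x,y)\in\mathbb R[x,y]$ be a palindromic real binary form of degree $n\ge 2$. Then $G_f(x,y)$ is self-inversive. If moreover $f$ is of odd degree, then $G_f(x,y)$ is palindromic.
   Context: A binary form $f(x,y)=\sum_{i=0}^n a_i x^i y^{n-i}$ of degree $n$ is palindromic if $a_i=a_{n-i}$ for all $i=0,\dots,n$. For a binary form $f$ of degree $n$ with partial derivatives $f_x, f_y$, define $$G_f(x,y)=\frac{x\cdot f_x\big(-f_y(x,y),\,f_x(x,y)\big)+y\cdot f_y\big(-f_y(x,y),\,f_x(x,y)\big)}{n\,f(x,y)}.$$ This is a polynomial, in fact a (possibly zero) binary form of degree $d=(n-1)(n-2)$ in $x,y$; write $G_f=\sum_{i=0}^d g_i x^i y^{d-i}$. $G_f$ is palindromic if $g_i=g_{d-i}$ for all $i=0,\dots,d$. $G_f$ is self-inversive if there is $w\in\mathbb C$ with $|w|=1$ such that $g_i=w\,\overline{g_{d-i}}$ for all $i=0,\dots,d$ (this is the coefficient form of the condition $p(z)=w\,z^d\,\bar p(1/z)$ for $p(z)=G_f(z,1)$, where $\bar p$ has the complex conjugate coefficients). *)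

theory Defs
  imports Complex_Main "HOL-Computational_Algebra.Polynomial"
begin

(* A polynomial in x and y over 'a is an element of 'a[x][y], of type 'a poly poly:
   the coefficient of x^i y^j in p is coeff (coeff p j) i. *)

abbreviation var_x :: "'a::comm_ring_1 poly poly" where
  "var_x \<equiv> [:[:0, 1:]:]"

abbreviation var_y :: "'a::comm_ring_1 poly poly" where
  "var_y \<equiv> [:0, 1:]"

definition partial_x :: "'a::idom poly poly \<Rightarrow> 'a poly poly" where
  "partial_x p = map_poly pderiv p"

definition partial_y :: "'a::idom poly poly \<Rightarrow> 'a poly poly" where
  "partial_y p = pderiv p"

(* p(u, v), where u is substituted for x and v for y. *)
definition subst2 ::
    "'a::comm_ring_1 poly poly \<Rightarrow> 'a poly poly \<Rightarrow> 'a poly poly \<Rightarrow> 'a poly poly" where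
  "subst2 p u v = poly (map_poly (\<lambda>c. poly (map_poly (\<lambda>a. [:[:a:]:]) c) u) p) v"

(* The zero polynomial is a binary form of every degree, so n is always given explicitly. *)
definition binary_form :: "nat \<Rightarrow> 'a::zero poly poly \<Rightarrow> bool" where
  "binary_form n p \<longleftrightarrow> (\<forall>i j. coeff (coeff p j) i \<noteq> 0 \<longrightarrow> i + j = n)"

(* The coefficient a_i of a form (sum over i \<le> n of a_i x^i y^(n - i)), for i \<le> n. *)
definition form_coeff :: "nat \<Rightarrow> 'a::zero poly poly \<Rightarrow> nat \<Rightarrow> 'a" where
  "form_coeff n p i = coeff (coeff p (n - i)) i"

definition palindromic :: "nat \<Rightarrow> 'a::zero poly poly \<Rightarrow> bool" where
  "palindromic n p \<longleftrightarrow>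
     binary_form n p \<and> (\<forall>i\<le>n. form_coeff n p i = form_coeff n p (n - i))"

definition self_inversive :: "nat \<Rightarrow> complex poly poly \<Rightarrow> bool" where
  "self_inversive n p \<longleftrightarrow>
     binary_form n p \<and>
     (\<exists>w::complex. cmod w = 1 \<and> (\<forall>i\<le>n. form_coeff n p i = w * cnj (form_coeff n p (n - i))))"

(* For a nonzero form f of degree n > 0 over a field of characteristic 0 the division is exact,
   so div is the quotient in the polynomial ring; for f = 0 the result is 0. *)
definition G_form :: "nat \<Rightarrow> 'a::field poly poly \<Rightarrow> 'a poly poly" where
  "G_form n f =
     (let fx = partial_x f; fy = partial_y f
      in (var_x * subst2 fx (- fy) fx + var_y * subst2 fy (- fy) fx) div (of_nat n * f))"

definition complexify :: "real poly poly \<Rightarrow> complex poly poly" where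
  "complexify p = map_poly (map_poly complex_of_real) p"

end

theory Submission
  imports Defs "HOL-Computational_Algebra.Field_as_Ring"
    "HOL-Computational_Algebra.Polynomial_Factorial"
begin

text \<open>
  Let \<open>N = x f\<^sub>x(-f\<^sub>y, f\<^sub>x) + y f\<^sub>y(-f\<^sub>y, f\<^sub>x)\<close> be the numerator of \<open>G\<^sub>f\<close>, and write \<open>n = m + 1\<close>, so
  that \<open>f\<^sub>x\<close> and \<open>f\<^sub>y\<close> are forms of degree \<open>m\<close>.

  The symmetry is a short computation. If \<open>f\<close> is palindromic then \<open>f(y, x) = f(x, y)\<close>, hence
  \<open>f\<^sub>y(u, v) = f\<^sub>x(v, u)\<close>. Exchanging \<open>x\<close> and \<open>y\<close> in \<open>N\<close> therefore gives
  \<open>y f\<^sub>x(-f\<^sub>x, f\<^sub>y) + x f\<^sub>y(-f\<^sub>x, f\<^sub>y) = y f\<^sub>y(f\<^sub>y, -f\<^sub>x) + x f\<^sub>x(f\<^sub>y, -f\<^sub>x)\<close>, and by homogeneity the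
  factor \<open>-1\<close> in both arguments comes out as \<open>(-1)\<^sup>m\<close>: the result is \<open>(-1)\<^sup>m N\<close>
  (\<open>G_numerator_swap\<close>). Division by the symmetric form \<open>n f\<close> yields
  \<open>G\<^sub>f(y, x) = (-1)\<^sup>m G\<^sub>f(x, y)\<close>, that is \<open>g\<^sub>i = (-1)\<^sup>m g\<^bsub>d-i\<^esub>\<close>. As the \<open>g\<^sub>i\<close> are real, \<open>G\<^sub>f\<close> is
  self-inversive with \<open>w = (-1)\<^sup>m\<close>, and for odd \<open>n\<close> this is \<open>w = 1\<close>, which makes \<open>G\<^sub>f\<close> palindromic.

  For this one has to know that the division is exact and that the quotient is a form of degree
  \<open>d = m (m - 1)\<close>. Modulo \<open>f\<close>, Euler's identity \<open>x f\<^sub>x + y f\<^sub>y = n f\<close> says that the vector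
  \<open>(-f\<^sub>y, f\<^sub>x)\<close> is proportional to \<open>(x, y)\<close>: multiplied by \<open>x\<close> it becomes \<open>-f\<^sub>y (x, y)\<close>, multiplied
  by \<open>y\<close> it becomes \<open>f\<^sub>x (x, y)\<close>. By homogeneity \<open>x\<^sup>m N \<equiv> (-f\<^sub>y)\<^sup>m (x f\<^sub>x + y f\<^sub>y) \<equiv> 0\<close> and likewise
  \<open>y\<^sup>m N \<equiv> 0\<close>, and since \<open>x\<^sup>m\<close> and \<open>y\<^sup>m\<close> are coprime, \<open>f\<close> divides \<open>N\<close>
  (\<open>form_dvd_G_numerator\<close>). That a quotient of forms is a form follows from a characterization of
  forms by a single equation, \<open>p(2x, 2y) = 2\<^sup>n p(x, y)\<close> (\<open>binary_form_iff_double\<close>), in which a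
  common factor can be cancelled.
\<close>

section \<open>Substitution as a ring homomorphism\<close>

lemma map_poly_hom_add:
  fixes h :: "'a::comm_ring_1 \<Rightarrow> 'b::comm_ring_1"
  assumes "h 0 = 0" and "\<And>a b. h (a + b) = h a + h b"
  shows "map_poly h (p + q) = map_poly h p + map_poly h q"
  by (rule poly_eqI) (simp add: coeff_map_poly assms)

lemma poly_map_poly_hom_mult:
  fixes h :: "'a::comm_ring_1 \<Rightarrow> 'b::comm_ring_1"
  assumes zero: "h 0 = 0" and add: "\<And>a b. h (a + b) = h a + h b"
    and mult: "\<And>a b. h (a * b) = h a * h b"
  shows "poly (map_poly h (p * q)) v = poly (map_poly h p) v * poly (map_poly h q) v"
proof (induction p)
  case 0
  show ?case by simp
next
  case (pCons a p)
  have "map_poly h (smult a q) = smult (h a) (map_poly h q)"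
    by (rule poly_eqI) (simp add: coeff_map_poly zero mult)
  then show ?case
    using pCons.IH
    by (simp add: map_poly_hom_add[OF zero add] map_poly_pCons zero algebra_simps)
qed

lemma subst2_add: "subst2 (p + q) u v = subst2 p u v + subst2 q u v"
  unfolding subst2_def by (subst map_poly_hom_add) (simp_all add: map_poly_hom_add)

lemma subst2_mult: "subst2 (p * q) u v = subst2 p u v * subst2 q u v"
  unfolding subst2_def
  by (rule poly_map_poly_hom_mult) (simp_all add: map_poly_hom_add poly_map_poly_hom_mult)

lemma subst2_0 [simp]: "subst2 0 u v = 0"
  by (simp add: subst2_def)

lemma subst2_uminus: "subst2 (- p) u v = - subst2 p u v"
  using subst2_add[of p "- p" u v] by (simp add: add_eq_0_iff)

lemma subst2_sum: "subst2 (\<Sum>i\<in>A. p i) u v = (\<Sum>i\<in>A. subst2 (p i) u v)"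
  by (induction A rule: infinite_finite_induct) (simp_all add: subst2_add)

lemma subst2_monom: "subst2 (monom (monom c i) j) u v = [:[:c:]:] * u ^ i * v ^ j"
  by (simp add: subst2_def map_poly_monom poly_monom)

lemma subst2_const [simp]: "subst2 [:[:c:]:] u v = [:[:c:]:]"
  using subst2_monom[of c 0 0 u v] by (simp add: monom_0)

lemma subst2_var_x [simp]: "subst2 var_x u v = u"
  using subst2_monom[of 1 1 0 u v] by (simp add: monom_0 monom_Suc flip: one_pCons)

lemma subst2_var_y [simp]: "subst2 var_y u v = v"
  using subst2_monom[of 1 0 1 u v] by (simp add: monom_0 monom_Suc flip: one_pCons)

lemma subst2_of_nat [simp]: "subst2 (of_nat k) u v = of_nat k"
  by (metis of_nat_poly subst2_const)

lemma subst2_power: "subst2 (p ^ k) u v = subst2 p u v ^ k"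
  using subst2_const[of 1 u v] by (induction k) (simp_all add: subst2_mult flip: one_pCons)

section \<open>Forms as sums of monomials\<close>

lemma monom_monom_eq: "monom (monom c i) j = [:[:c:]:] * var_x ^ i * var_y ^ j"
proof -
  have x: "var_x ^ i = [:monom (1::'a) i:]"
    by (induction i) (simp_all add: monom_Suc one_pCons)
  have y: "var_y ^ j = monom (1::'a poly) j"
    by (simp add: monom_altdef)
  show ?thesis unfolding x y by (simp add: smult_monom)
qed

lemma form_coeff_sum:
  assumes "i \<le> n"
  shows "form_coeff n (\<Sum>k\<le>n. monom (monom (c k) k) (n - k)) i = c i"
proof -
  have "form_coeff n (\<Sum>k\<le>n. monom (monom (c k) k) (n - k)) i
      = (\<Sum>k\<le>n. if k = i then c k else 0)"
    unfolding form_coeff_def coeff_sum using assms by (intro sum.cong) auto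
  then show ?thesis using assms by simp
qed

lemma form_eq_sum:
  assumes "binary_form n p"
  shows "p = (\<Sum>k\<le>n. monom (monom (form_coeff n p k) k) (n - k))" (is "p = ?s")
proof (intro poly_eqI)
  fix i j
  have *: "coeff (coeff ?s j) i
      = (\<Sum>k\<le>n. if k = i then (if n - k = j then form_coeff n p k else 0) else 0)"
    unfolding coeff_sum by (intro sum.cong) auto
  show "coeff (coeff p j) i = coeff (coeff ?s j) i"
  proof (cases "i + j = n")
    case True
    then show ?thesis unfolding * by (auto simp: form_coeff_def)
  next
    case False
    then show ?thesis unfolding * using assms by (auto simp: binary_form_def)
  qed
qed

lemma subst2_form:
  assumes "binary_form n p"
  shows "subst2 p u v = (\<Sum>k\<le>n. [:[:form_coeff n p k:]:] * u ^ k * v ^ (n - k))"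
  by (subst form_eq_sum[OF assms]) (simp add: subst2_sum subst2_monom)

lemma subst2_form_var:
  assumes "binary_form n p"
  shows "subst2 p var_x var_y = p"
  by (subst (2) form_eq_sum[OF assms]) (simp add: subst2_form[OF assms] monom_monom_eq)

text \<open>
  The factor \<open>c\<close> may be any polynomial. This is what allows homogeneity to be used with \<open>x\<close>, \<open>y\<close> or
  a partial derivative as the scalar.
\<close>

lemma subst2_form_scale:
  assumes "binary_form n p"
  shows "subst2 p (c * u) (c * v) = c ^ n * subst2 p u v"
proof -
  have "a * (c * u) ^ k * (c * v) ^ (n - k) = c ^ n * (a * u ^ k * v ^ (n - k))"
    if "k \<le> n" for a k
  proof -
    have "c ^ n = c ^ k * c ^ (n - k)" using that by (simp flip: power_add)
    then show ?thesis by (simp only: power_mult_distrib mult_ac)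
  qed
  then show ?thesis
    unfolding subst2_form[OF assms] sum_distrib_left by (intro sum.cong) (auto simp del: mult_pCons_left)
qed

lemma subst2_subst2_form:
  assumes "binary_form n p"
  shows "subst2 (subst2 p a b) u v = subst2 p (subst2 a u v) (subst2 b u v)"
  by (simp add: subst2_form[OF assms] subst2_sum subst2_mult subst2_power del: mult_pCons_left)

lemma subst2_form_cong_dvd:
  assumes p: "binary_form n p" and u: "d dvd u - u'" and v: "d dvd v - v'"
  shows "d dvd subst2 p u v - subst2 p u' v'"
proof -
  have pow: "a - b dvd a ^ k - b ^ k" for a b :: "'a poly poly" and k
    by (simp add: power_diff_sumr2)
  have "d dvd c * u ^ k * v ^ l - c * u' ^ k * v' ^ l" for c k l
  proof -
    have "c * u ^ k * v ^ l - c * u' ^ k * v' ^ l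
        = c * v ^ l * (u ^ k - u' ^ k) + c * u' ^ k * (v ^ l - v' ^ l)"
      by (simp add: algebra_simps)
    then show ?thesis
      using dvd_trans[OF u pow] dvd_trans[OF v pow] by simp
  qed
  then show ?thesis
    unfolding subst2_form[OF p] sum_subtractf[symmetric] by (intro dvd_sum) (auto simp del: mult_pCons_left)
qed

text \<open>
  Since \<open>p\<close> is arbitrary here, it has no expression by \<open>form_coeff\<close>; the argument is an induction
  that peels off the coefficient of \<open>y\<^sup>0\<close>.
\<close>

lemma coeff_subst2_double:
  fixes p :: "'a::comm_ring_1 poly poly"
  shows "coeff (coeff (subst2 p (2 * var_x) (2 * var_y)) j) i = 2 ^ (i + j) * coeff (coeff p j) i"
proof (induction p arbitrary: j)
  case 0
  show ?case by simp
next
  case (pCons c p)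
  have v: "2 * var_y = ([:0, [:2:]:] :: 'a poly poly)" and u: "2 * var_x = ([:[:0, 2:]:] :: 'a poly poly)"
    by (simp_all add: numeral_poly)
  have inner: "poly (map_poly (\<lambda>a. [:[:a:]:]) c) [:[:0, 2:]:] = [:c \<circ>\<^sub>p [:0, 2:]:]" for c :: "'a poly"
    by (induction c) (simp_all add: map_poly_pCons pcompose_pCons)
  have co: "coeff (c \<circ>\<^sub>p [:0, 2:]) i = 2 ^ i * coeff c i"
    by (simp add: coeff_pcompose_linear)
  have "subst2 (pCons c p) (2 * var_x) (2 * var_y)
      = pCons (c \<circ>\<^sub>p [:0, 2:]) (smult [:2:] (subst2 p (2 * var_x) (2 * var_y)))"
    unfolding u v by (simp add: subst2_def map_poly_pCons inner)
  then show ?case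
    using pCons.IH by (cases j) (simp_all only: coeff_pCons_0 coeff_pCons_Suc coeff_smult co, simp_all add: mult_ac)
qed

text \<open>
  The scalar 2 detects the degree of a monomial because its powers are distinct in characteristic 0.
\<close>

lemma binary_form_iff_double:
  fixes p :: "'a::field_char_0 poly poly"
  shows "binary_form n p \<longleftrightarrow> subst2 p (2 * var_x) (2 * var_y) = 2 ^ n * p"
proof -
  have two: "(2::'a poly poly) ^ n * p = smult [:2 ^ n:] p"
    by (simp add: numeral_poly poly_const_pow)
  have pow: "(2::'a) ^ k = 2 ^ l \<longleftrightarrow> k = l" for k l
    by (metis of_nat_eq_iff of_nat_numeral of_nat_power power_inject_exp one_less_numeral_iff semiring_norm(76))
  show ?thesis
    unfolding two binary_form_def poly_eq_iff coeff_subst2_double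
    by (auto simp: pow)
qed

lemma binary_form_quotient:
  fixes f g :: "'a::field_char_0 poly poly"
  assumes f: "binary_form n f" "f \<noteq> 0" and fg: "binary_form (n + d) (f * g)"
  shows "binary_form d g"
proof -
  have "2 ^ n * f * subst2 g (2 * var_x) (2 * var_y) = 2 ^ (n + d) * (f * g)"
    using f(1) fg by (simp add: binary_form_iff_double subst2_mult)
  then have "(2 ^ n * f) * subst2 g (2 * var_x) (2 * var_y) = (2 ^ n * f) * (2 ^ d * g)"
    by (simp add: power_add mult_ac)
  then show ?thesis using f(2) by (simp add: binary_form_iff_double)
qed

section \<open>Partial derivatives of forms\<close>

lemma coeff_partial_x:
  "coeff (coeff (partial_x p) j) i = of_nat (Suc i) * coeff (coeff p j) (Suc i)"
  by (simp add: partial_x_def coeff_map_poly coeff_pderiv)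

lemma coeff_partial_y:
  "coeff (coeff (partial_y p) j) i = of_nat (Suc j) * coeff (coeff p (Suc j)) i"
  by (simp add: partial_y_def coeff_pderiv of_nat_poly del: of_nat_Suc)

lemma binary_form_partial:
  assumes "binary_form (Suc m) f"
  shows "binary_form m (partial_x f)" and "binary_form m (partial_y f)"
  using assms unfolding binary_form_def coeff_partial_x coeff_partial_y
  by (metis add_Suc add_Suc_right mult_zero_right nat.inject)+

lemma euler_identity:
  assumes "binary_form n f"
  shows "var_x * partial_x f + var_y * partial_y f = of_nat n * f"
proof (intro poly_eqI)
  fix i j
  have "coeff (coeff (var_x * partial_x f + var_y * partial_y f) j) i
      = of_nat (i + j) * coeff (coeff f j) i"
    by (cases i; cases j) (simp_all add: coeff_partial_x coeff_partial_y coeff_pCons algebra_simps)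
  also have "\<dots> = of_nat n * coeff (coeff f j) i"
    using assms by (cases "coeff (coeff f j) i = 0") (auto simp: binary_form_def)
  finally show "coeff (coeff (var_x * partial_x f + var_y * partial_y f) j) i
      = coeff (coeff (of_nat n * f) j) i"
    by (simp add: of_nat_poly)
qed

section \<open>Exactness of the division\<close>

definition G_numerator :: "'a::field poly poly \<Rightarrow> 'a poly poly" where
  "G_numerator f =
     var_x * subst2 (partial_x f) (- partial_y f) (partial_x f)
     + var_y * subst2 (partial_y f) (- partial_y f) (partial_x f)"

text \<open>
  A common divisor of \<open>x\<close> and \<open>y\<close> has degree 0 in \<open>y\<close> and divides the coefficient 1 of \<open>y\<close>, so \<open>x\<^sup>k\<close>
  and \<open>y\<^sup>k\<close> are coprime, and \<open>g\<close> is the greatest common divisor of \<open>x\<^sup>k g\<close> and \<open>y\<^sup>k g\<close> up to units.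
\<close>

lemma dvd_if_dvd_var_power_mult:
  fixes f g :: "'a::{factorial_ring_gcd, semiring_gcd_mult_normalize, comm_ring_1} poly poly"
  assumes "f dvd var_x ^ k * g" and "f dvd var_y ^ k * g"
  shows "f dvd g"
proof -
  have "coprime var_x (var_y :: 'a poly poly)"
  proof (rule coprimeI)
    fix d :: "'a poly poly"
    assume x: "d dvd var_x" and y: "d dvd var_y"
    have "degree d = 0"
      using dvd_imp_degree_le[OF x] by simp
    then obtain c where c: "d = [:c:]" by (rule degree_eq_zeroE)
    have "c dvd coeff var_y 1"
      using y unfolding c const_poly_dvd_iff by blast
    then show "is_unit d" by (simp add: c is_unit_const_poly_iff)
  qed
  then have "coprime (var_x ^ k) (var_y ^ k :: 'a poly poly)" by simp
  moreover have "f dvd gcd (g * var_x ^ k) (g * var_y ^ k)"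
    using assms by (simp add: mult.commute)
  ultimately show ?thesis
    by (metis dvd_normalize_iff gcd_mult_left mult.right_neutral coprime_imp_gcd_eq_1)
qed

text \<open>
  The hypotheses say \<open>s (-f\<^sub>y, f\<^sub>x) \<equiv> z (x, y)\<close> modulo \<open>f\<close>. Evaluating a form \<open>p\<close> of degree \<open>m\<close> at both
  vectors gives \<open>s\<^sup>m p(-f\<^sub>y, f\<^sub>x) \<equiv> z\<^sup>m p(x, y)\<close>; with \<open>p = f\<^sub>x\<close> and \<open>p = f\<^sub>y\<close>, the numerator times
  \<open>s\<^sup>m\<close> is congruent to \<open>z\<^sup>m (x f\<^sub>x + y f\<^sub>y)\<close>, which vanishes by Euler's identity.
\<close>

lemma form_dvd_power_mult_G_numerator:
  fixes f s z :: "'a::field poly poly"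
  assumes f: "binary_form (Suc m) f"
    and x: "f dvd s * (- partial_y f) - z * var_x" and y: "f dvd s * partial_x f - z * var_y"
  shows "f dvd s ^ m * G_numerator f"
proof -
  let ?fx = "partial_x f" and ?fy = "partial_y f"
  note form = binary_form_partial[OF f]
  have cong: "f dvd s ^ m * subst2 p (- ?fy) ?fx - z ^ m * p" if p: "binary_form m p" for p
    using subst2_form_cong_dvd[OF p x y] unfolding subst2_form_scale[OF p] subst2_form_var[OF p] .
  have euler: "f dvd var_x * ?fx + var_y * ?fy"
    unfolding euler_identity[OF f] by simp
  have "s ^ m * G_numerator f =
      var_x * (s ^ m * subst2 ?fx (- ?fy) ?fx - z ^ m * ?fx)
      + var_y * (s ^ m * subst2 ?fy (- ?fy) ?fx - z ^ m * ?fy)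
      + z ^ m * (var_x * ?fx + var_y * ?fy)"
    unfolding G_numerator_def by (simp only: algebra_simps)
  also have "f dvd \<dots>"
    by (rule dvd_add[OF dvd_add[OF dvd_mult[OF cong[OF form(1)]] dvd_mult[OF cong[OF form(2)]]]
          dvd_mult[OF euler]])
  finally show ?thesis .
qed

text \<open>
  The two instances of the previous lemma are \<open>s = x\<close>, \<open>z = -f\<^sub>y\<close> and \<open>s = y\<close>, \<open>z = f\<^sub>x\<close>; in each, one
  congruence is an equality and the other is Euler's identity.
\<close>

lemma form_dvd_G_numerator:
  fixes f :: "'a::{field_char_0, factorial_ring_gcd, semiring_gcd_mult_normalize} poly poly"
  assumes f: "binary_form (Suc m) f"
  shows "f dvd G_numerator f"
proof (rule dvd_if_dvd_var_power_mult)
  let ?fx = "partial_x f" and ?fy = "partial_y f"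
  have euler: "f dvd var_x * ?fx + var_y * ?fy"
    unfolding euler_identity[OF f] by simp
  show "f dvd var_x ^ m * G_numerator f"
  proof (rule form_dvd_power_mult_G_numerator[OF f])
    show "f dvd var_x * - ?fy - (- ?fy) * var_x"
      by (simp only: mult.commute[of var_x] diff_self dvd_0_right)
    have "var_x * ?fx - (- ?fy) * var_y = var_x * ?fx + var_y * ?fy"
      by (simp only: mult.commute[of _ ?fy] mult_minus_left diff_minus_eq_add)
    then show "f dvd var_x * ?fx - (- ?fy) * var_y"
      using euler by (simp only:)
  qed
  show "f dvd var_y ^ m * G_numerator f"
  proof (rule form_dvd_power_mult_G_numerator[OF f])
    have "var_y * - ?fy - ?fx * var_x = - (var_x * ?fx + var_y * ?fy)"
      by (simp only: mult.commute[of _ ?fx] mult_minus_right minus_add_distrib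
          diff_conv_add_uminus add.commute)
    then show "f dvd var_y * - ?fy - ?fx * var_x"
      using euler by (simp only: dvd_minus_iff)
    show "f dvd var_y * ?fx - ?fx * var_y"
      by (simp only: mult.commute[of var_y] diff_self dvd_0_right)
  qed
qed

lemma G_form_exact:
  fixes f :: "'a::{field_char_0, factorial_ring_gcd, semiring_gcd_mult_normalize} poly poly"
  assumes f: "binary_form (Suc m) f" "f \<noteq> 0"
  shows "of_nat (Suc m) * f * G_form (Suc m) f = G_numerator f"
proof -
  have "1 = of_nat (Suc m) * ([:[:inverse (of_nat (Suc m)):]:] :: 'a poly poly)"
    by (simp add: of_nat_poly one_pCons del: of_nat_Suc)
  then have "is_unit (of_nat (Suc m) :: 'a poly poly)" by (rule dvdI)
  then have "of_nat (Suc m) * f dvd G_numerator f"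
    using form_dvd_G_numerator[OF f(1)] by (simp add: mult_unit_dvd_iff' del: of_nat_Suc)
  then show ?thesis
    by (simp add: G_form_def G_numerator_def Let_def del: of_nat_Suc)
qed

text \<open>
  Doubling the variables multiplies \<open>f\<^sub>x\<close> and \<open>f\<^sub>y\<close> by \<open>2\<^sup>m\<close>, hence the value of a form of degree \<open>m\<close>
  at \<open>(-f\<^sub>y, f\<^sub>x)\<close> by \<open>(2\<^sup>m)\<^sup>m\<close>.
\<close>

lemma binary_form_G_numerator:
  fixes f :: "'a::field_char_0 poly poly"
  assumes f: "binary_form (Suc m) f"
  shows "binary_form (Suc (m * m)) (G_numerator f)"
proof -
  note form = binary_form_partial[OF f]
  note double = form[unfolded binary_form_iff_double]
  have *: "subst2 (subst2 p (- partial_y f) (partial_x f)) (2 * var_x) (2 * var_y)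
      = 2 ^ (m * m) * subst2 p (- partial_y f) (partial_x f)" if p: "binary_form m p" for p
    using subst2_form_scale[OF p, of "2 ^ m" "- partial_y f" "partial_x f"]
    by (simp add: subst2_subst2_form[OF p] subst2_uminus double power_mult
        del: mult_pCons_left mult_pCons_right)
  show ?thesis
    unfolding binary_form_iff_double G_numerator_def subst2_add subst2_mult
      subst2_var_x subst2_var_y *[OF form(1)] *[OF form(2)]
    by (simp add: algebra_simps)
qed

lemma binary_form_G_form:
  fixes f :: "'a::{field_char_0, factorial_ring_gcd, semiring_gcd_mult_normalize} poly poly"
  assumes f: "binary_form (Suc (Suc k)) f" "f \<noteq> 0"
  shows "binary_form (Suc k * k) (G_form (Suc (Suc k)) f)"
proof -
  let ?n = "Suc (Suc k)"
  have "binary_form ?n (of_nat ?n * f)"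
    using f(1) unfolding binary_form_iff_double subst2_mult subst2_of_nat by (simp only: mult_ac)
  moreover have "of_nat ?n * f \<noteq> 0"
    using f(2) by (simp del: of_nat_Suc)
  moreover have "binary_form (?n + Suc k * k) (of_nat ?n * f * G_form ?n f)"
    unfolding G_form_exact[OF f] using binary_form_G_numerator[OF f(1)]
    by (simp add: algebra_simps)
  ultimately show ?thesis by (rule binary_form_quotient)
qed

section \<open>Exchanging the variables\<close>

lemma form_coeff_reverse:
  assumes p: "binary_form n p" and q: "binary_form n q"
    and rev: "\<And>i. i \<le> n \<Longrightarrow> form_coeff n q i = form_coeff n p (n - i)"
  shows "subst2 q u v = subst2 p v u"
  unfolding subst2_form[OF p] subst2_form[OF q]
  by (subst sum.nat_diff_reindex[symmetric, of _ "Suc n", unfolded lessThan_Suc_atMost])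
     (intro sum.cong, auto simp: rev mult_ac)

lemma form_coeff_swap:
  assumes p: "binary_form n p" and "i \<le> n"
  shows "form_coeff n (subst2 p var_y var_x) i = form_coeff n p (n - i)"
proof -
  have "subst2 p var_y var_x = (\<Sum>k\<le>n. monom (monom (form_coeff n p (n - k)) k) (n - k))"
    unfolding subst2_form[OF p] monom_monom_eq
    by (subst sum.nat_diff_reindex[symmetric, of _ "Suc n", unfolded lessThan_Suc_atMost])
       (intro sum.cong, auto simp: mult_ac)
  then show ?thesis using assms by (simp add: form_coeff_sum)
qed

text \<open>
  The coefficients of \<open>f\<^sub>y\<close> are \<open>(n - i) a\<^sub>i\<close>, and those of \<open>f\<^sub>x\<close> in reverse order are
  \<open>(n - i) a\<^bsub>n-i\<^esub>\<close>.
\<close>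

lemma palindromic_partial:
  assumes f: "palindromic (Suc m) f"
  shows "subst2 (partial_y f) u v = subst2 (partial_x f) v u"
proof -
  have form: "binary_form (Suc m) f" using f unfolding palindromic_def by blast
  have "form_coeff m (partial_y f) i = form_coeff m (partial_x f) (m - i)" if "i \<le> m" for i
  proof -
    have "form_coeff (Suc m) f i = form_coeff (Suc m) f (Suc m - i)"
      using f that unfolding palindromic_def by (meson le_SucI)
    then show ?thesis
      using that by (simp add: form_coeff_def coeff_partial_x coeff_partial_y Suc_diff_le)
  qed
  then show ?thesis
    by (rule form_coeff_reverse[OF binary_form_partial[OF form]])
qed

text \<open>
  Exchanging the variables turns the point \<open>(-f\<^sub>y, f\<^sub>x)\<close> into \<open>(-f\<^sub>x, f\<^sub>y)\<close>. Exchanging the two arguments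
  of \<open>f\<^sub>x\<close> and \<open>f\<^sub>y\<close> as well brings this to \<open>(f\<^sub>y, -f\<^sub>x)\<close>, the negative of the original point; this
  negation is the source of the sign.
\<close>

lemma G_numerator_swap:
  assumes f: "palindromic (Suc m) f"
  shows "subst2 (G_numerator f) var_y var_x = (- 1) ^ m * G_numerator f"
proof -
  let ?fx = "partial_x f" and ?fy = "partial_y f"
  have form: "binary_form (Suc m) f" using f unfolding palindromic_def by blast
  note form' = binary_form_partial[OF form]
  note pal = palindromic_partial[OF f]
  have fy: "subst2 ?fy var_y var_x = ?fx"
    by (simp add: pal subst2_form_var[OF form'(1)])
  have fx: "subst2 ?fx var_y var_x = ?fy"
    by (simp add: subst2_form_var[OF form'(2)] flip: pal)
  have neg: "subst2 p ?fy (- ?fx) = (- 1) ^ m * subst2 p (- ?fy) ?fx" if "binary_form m p" for p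
    using subst2_form_scale[OF that, of "- 1" "- ?fy" ?fx] by simp
  have "subst2 (G_numerator f) var_y var_x
      = var_y * subst2 ?fx (- ?fx) ?fy + var_x * subst2 ?fy (- ?fx) ?fy"
    unfolding G_numerator_def
    by (simp add: subst2_add subst2_mult subst2_uminus subst2_subst2_form[OF form'(1)]
        subst2_subst2_form[OF form'(2)] fx fy del: mult_pCons_left mult_pCons_right)
  also have "\<dots> = var_y * subst2 ?fy ?fy (- ?fx) + var_x * subst2 ?fx ?fy (- ?fx)"
    by (simp only: pal)
  also have "\<dots> = (- 1) ^ m * G_numerator f"
    unfolding neg[OF form'(1)] neg[OF form'(2)] G_numerator_def by (simp only: algebra_simps)
  finally show ?thesis .
qed

lemma G_form_swap:
  fixes f :: "'a::{field_char_0, factorial_ring_gcd, semiring_gcd_mult_normalize} poly poly"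
  assumes f: "palindromic (Suc m) f" "f \<noteq> 0"
  shows "subst2 (G_form (Suc m) f) var_y var_x = (- 1) ^ m * G_form (Suc m) f"
proof -
  let ?G = "G_form (Suc m) f" and ?a = "of_nat (Suc m) * f"
  have form: "binary_form (Suc m) f" using f unfolding palindromic_def by blast
  have swap: "subst2 f var_y var_x = f"
    using form_coeff_reverse[OF form form] f(1) subst2_form_var[OF form]
    unfolding palindromic_def by metis
  have "?a * subst2 ?G var_y var_x = subst2 (?a * ?G) var_y var_x"
    by (simp add: subst2_mult swap del: of_nat_Suc)
  also have "\<dots> = (- 1) ^ m * (?a * ?G)"
    by (simp only: G_form_exact[OF form f(2)] G_numerator_swap[OF f(1)])
  also have "\<dots> = ?a * ((- 1) ^ m * ?G)"
    by (simp only: mult_ac)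
  finally show ?thesis
    using f(2) by (simp del: of_nat_Suc)
qed

text \<open>
  Here \<open>n = k + 2\<close>, so that the degree \<open>(n - 1)(n - 2)\<close> is \<open>(k + 1) k\<close> without truncated subtraction.
\<close>

lemma form_coeff_G_form:
  fixes f :: "'a::{field_char_0, factorial_ring_gcd, semiring_gcd_mult_normalize} poly poly"
  assumes f: "palindromic (Suc (Suc k)) f" "f \<noteq> 0" and i: "i \<le> Suc k * k"
  shows "form_coeff (Suc k * k) (G_form (Suc (Suc k)) f) i
    = (- 1) ^ Suc k * form_coeff (Suc k * k) (G_form (Suc (Suc k)) f) (Suc k * k - i)"
proof -
  let ?G = "G_form (Suc (Suc k)) f" and ?d = "Suc k * k"
  have G: "binary_form ?d ?G"
    using f unfolding palindromic_def by (blast intro: binary_form_G_form)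
  have "form_coeff ?d ((- 1) ^ Suc k * ?G) i = (- 1) ^ Suc k * form_coeff ?d ?G i"
    by (cases "even k") (simp_all add: form_coeff_def)
  then have "form_coeff ?d ?G (?d - i) = (- 1) ^ Suc k * form_coeff ?d ?G i"
    using form_coeff_swap[OF G i] by (simp only: G_form_swap[OF f])
  then show ?thesis by (cases "even k") simp_all
qed

lemma coeff_complexify:
  "coeff (coeff (complexify p) j) i = complex_of_real (coeff (coeff p j) i)"
  by (simp add: complexify_def coeff_map_poly)

theorem theorem6:
  fixes f :: "real poly poly" and n :: nat
  assumes "n \<ge> 2"
    and "f \<noteq> 0"
    and "palindromic n f"
  shows "self_inversive ((n - 1) * (n - 2)) (complexify (G_form n f)) \<and>
    (odd n \<longrightarrow> palindromic ((n - 1) * (n - 2)) (G_form n f))"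
proof -
  obtain k where n: "n = Suc (Suc k)"
    using assms(1) by (metis add_2_eq_Suc le_Suc_ex)
  let ?d = "Suc k * k" and ?G = "G_form n f"
  have d: "(n - 1) * (n - 2) = ?d" by (simp add: n)
  have form: "binary_form ?d ?G"
    using assms(2,3) unfolding n palindromic_def by (blast intro: binary_form_G_form)
  have sym: "form_coeff ?d ?G i = (- 1) ^ Suc k * form_coeff ?d ?G (?d - i)" if "i \<le> ?d" for i
    using form_coeff_G_form[of k f i] assms(2,3) that unfolding n by blast
  have formC: "binary_form ?d (complexify ?G)"
    using form by (simp add: binary_form_def coeff_complexify)
  have coeffC: "form_coeff ?d (complexify ?G) i = complex_of_real (form_coeff ?d ?G i)" for i
    by (simp only: form_coeff_def coeff_complexify)
  have "form_coeff ?d (complexify ?G) i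
      = (- 1) ^ Suc k * cnj (form_coeff ?d (complexify ?G) (?d - i))" if "i \<le> ?d" for i
    unfolding coeffC sym[OF that] by simp
  moreover have "cmod ((- 1) ^ Suc k) = 1"
    by (simp add: norm_power)
  ultimately have "self_inversive ?d (complexify ?G)"
    using formC unfolding self_inversive_def by blast
  moreover have "palindromic ?d ?G" if "odd n"
  proof -
    have "(- 1 :: real) ^ Suc k = 1" using that by (simp add: n)
    then show ?thesis using form sym unfolding palindromic_def by (metis mult_1)
  qed
  ultimately show ?thesis unfolding d by blast
qed

end
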